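(* Let $\{x_k\}_{k\ge1}$ be generated by the projected subgradient method with initial point $x_1\in\mathcal{T}_{1/2}$ and square-summable but not summable step-sizes $\alpha_k$, i.e. $\alpha_k\ge0$, $\sum_{k=1}^\infty\alpha_k=\infty$, $\sum_{k=1}^\infty\alpha_k^2<\infty$, satisfying in addition, for all $k$, $$0\le\alpha_k<\min\left\{1,\ \min\Big\{1,\frac{\mu}{L}\Big\}\Big(\frac{\mu}{2\rho}\Big)^{\frac1{\delta(1+\nu)-1}}\right\}.$$ Then, with $f_k^*:=\min\{f(x_i):i=1,\dots,k\}$, $$\lim_{k\to\infty}f(x_k)=\lim_{k\to\infty}f_k^*=f^*\qquad\text{and}\qquad\lim_{k\to\infty}\operatorname{dist}(x_k;\mathcal{X}^* )=0.$$
   Context: $\|\cdot\|$ is the Euclidean norm on $\mathbb{R}^n$, $\operatorname{dist}(x;S)=\inf_{z\in S}\|z-x\|$, $\operatorname{proj}_X$ is the Euclidean projection onto $X$, $\operatorname{dom}(f)=\{x:f(x)<+\infty\}$, and $\partial f$ is the Clarke subdifferential. Standing assumptions: $f:\mathbb{R}^n\to\mathbb{R}\cup\{+\infty\}$ is proper; $X\subseteq\operatorname{dom}(f)$ is nonempty, closed and convex; the set of minimizers $\mathcal{X}^*=\operatorname{argmin}_{x\in X}f(x)$ is nonempty and $f^*$ is the minimal value of $f$ over $X$. The parameters satisfy $\rho>0$, $0<\nu\le1$, $\frac1{1+\nu}<\delta\le1$, $\mu>0$, and: (i) $f$ is $\nu$-paraconvex with constant $\rho$ on an open convex set $X'$ with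 $X\subseteq X'\subseteq\operatorname{dom}(f)$, i.e. $f(\lambda x+(1-\lambda)y)\le\lambda f(x)+(1-\lambda)f(y)+\rho\min\{\lambda,1-\lambda\}\|x-y\|^{1+\nu}$ for all $x,y\in X'$, $\lambda\in[0,1]$ (consequently $f$ is locally Lipschitz on $X'$); (ii) Hölderian error bound: $\mu\operatorname{dist}^{1/\delta}(x;\mathcal{X}^* )\le f(x)-f^*$ for all $x\in X$. For $\gamma\in(0,1]$ let $\mathcal{T}_\gamma=\big\{x\in X:\operatorname{dist}(x;\mathcal{X}^* )<(\gamma\mu/\rho)^{\delta/(\delta(1+\nu)-1)}\big\}$. Let $L=\sup\{\|\zeta\|:\zeta\in\partial f(x),\ x\in\mathcal{T}_1\}$, with $0<L<\infty$. Projected subgradient method with step-sizes $\alpha_k$: from the initial point, at each iteration choose any $\zeta_k\in\partial f(x_k)$ and set $x_{k+1}=\operatorname{proj}_X\big(x_k-\alpha_k\zeta_k/\|\zeta_k\|\big)$; if $\zeta_k=0$, set $x_{k+1}=x_k$. *)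

theory Defs
  imports "HOL-Analysis.Analysis"
begin

definition effective_domain :: "('a \<Rightarrow> ereal) \<Rightarrow> 'a set" where
  "effective_domain f = {x. f x < \<infinity>}"

definition proper_fun :: "('a \<Rightarrow> ereal) \<Rightarrow> bool" where
  "proper_fun f \<longleftrightarrow> (\<forall>x. f x \<noteq> -\<infinity>) \<and> effective_domain f \<noteq> {}"

definition argmin_set :: "('a \<Rightarrow> ereal) \<Rightarrow> 'a set \<Rightarrow> 'a set" where
  "argmin_set f X = {x. is_arg_min f (\<lambda>z. z \<in> X) x}"

definition min_value :: "('a \<Rightarrow> ereal) \<Rightarrow> 'a set \<Rightarrow> ereal" where
  "min_value f X = (INF x\<in>X. f x)"

definition paraconvex_on ::
    "'a::real_normed_vector set \<Rightarrow> real \<Rightarrow> real \<Rightarrow> ('a \<Rightarrow> ereal) \<Rightarrow> bool" where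
  "paraconvex_on S \<nu> \<rho> f \<longleftrightarrow>
     (\<forall>x\<in>S. \<forall>y\<in>S. \<forall>t\<in>{0..1}.
        f (t *\<^sub>R x + (1 - t) *\<^sub>R y)
          \<le> ereal t * f x + ereal (1 - t) * f y
            + ereal (\<rho> * min t (1 - t) * norm (x - y) powr (1 + \<nu>)))"

text \<open>
  The Clarke subdifferential is defined through the generalized directional derivative
  f\<degree>(x; v) = limsup (f (y + t v) - f y) / t as y tends to x (y = x allowed) and t decreases to 0.
  This is Clarke's definition at points near which f is finite and locally Lipschitz; at other
  points the value is not meant to agree with the extension via normal cones to the epigraph.
\<close>

definition clarke_deriv :: "('a::real_normed_vector \<Rightarrow> ereal) \<Rightarrow> 'a \<Rightarrow> 'a \<Rightarrow> ereal" where
  "clarke_deriv f x v =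
     Limsup (nhds x \<times>\<^sub>F at_right (0::real)) (\<lambda>(y, t). (f (y + t *\<^sub>R v) - f y) / ereal t)"

definition clarke_subdiff :: "('a::real_inner \<Rightarrow> ereal) \<Rightarrow> 'a \<Rightarrow> 'a set" where
  "clarke_subdiff f x = {\<zeta>. \<forall>v. ereal (\<zeta> \<bullet> v) \<le> clarke_deriv f x v}"

definition holder_error_bound ::
    "('a::metric_space \<Rightarrow> ereal) \<Rightarrow> 'a set \<Rightarrow> real \<Rightarrow> real \<Rightarrow> bool" where
  "holder_error_bound f X \<mu> \<delta> \<longleftrightarrow>
     (\<forall>x\<in>X. ereal (\<mu> * infdist x (argmin_set f X) powr (1 / \<delta>)) \<le> f x - min_value f X)"

definition tube ::
    "('a::metric_space \<Rightarrow> ereal) \<Rightarrow> 'a set \<Rightarrow> real \<Rightarrow> real \<Rightarrow> real \<Rightarrow> real \<Rightarrow> real \<Rightarrow> 'a set" where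
  "tube f X \<nu> \<rho> \<delta> \<mu> \<gamma> =
     {x \<in> X. infdist x (argmin_set f X) < (\<gamma> * \<mu> / \<rho>) powr (\<delta> / (\<delta> * (1 + \<nu>) - 1))}"

text \<open>Sequences are indexed from 1; the values at index 0 are irrelevant.\<close>

definition projected_subgradient ::
    "('a::euclidean_space \<Rightarrow> ereal) \<Rightarrow> 'a set \<Rightarrow> (nat \<Rightarrow> real) \<Rightarrow> (nat \<Rightarrow> 'a) \<Rightarrow> (nat \<Rightarrow> 'a) \<Rightarrow> bool" where
  "projected_subgradient f X \<alpha> \<zeta> x \<longleftrightarrow>
     (\<forall>k\<ge>1. \<zeta> k \<in> clarke_subdiff f (x k) \<and>
        x (Suc k) = (if \<zeta> k = 0 then x k
                     else closest_point X (x k - (\<alpha> k / norm (\<zeta> k)) *\<^sub>R \<zeta> k)))"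

end

theory Submission
  imports Defs
begin

text \<open>
  Write \<open>D\<close> for the distance to the set of minimizers, \<open>p\<close> for a minimizer nearest to \<open>u\<close>, and
  \<open>R\<close> for the radius of the tube with parameter \<open>1/2\<close>.  A Clarke subgradient \<open>z\<close> of a paraconvex
  function obeys the convex subgradient inequality up to an error of order \<open>1 + \<nu>\<close>
  (\<open>clarke_subgradient_inequality\<close>).  Tested at \<open>p\<close> it says
  \<open>f u - f p \<le> z \<bullet> (u - p) + \<rho> * D u powr (1 + \<nu>)\<close>, and this single estimate is used twice.

  Bounding its left side from below by the error bound \<open>\<mu> * D u powr (1 / \<delta>)\<close>: since
  \<open>1 + \<nu> > 1 / \<delta>\<close>, the error term is of higher order in \<open>D u\<close>, and \<open>R\<close> is exactly the radius below
  which it is at most half of the error bound.  Hence \<open>z \<bullet> (u - p) \<ge> \<mu> / 2 * D u powr (1 / \<delta>)\<close>, and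
  as projections are nonexpansive and \<open>norm z \<le> L\<close>, a step of length \<open>a\<close> leads to a point \<open>u'\<close> with
  \<open>(D u')\<^sup>2 \<le> (D u)\<^sup>2 - (\<mu> / L) * a * D u powr (1 / \<delta>) + a\<^sup>2\<close>.
  The bound on the step sizes keeps the iterates in the tube (\<open>radius_preserved\<close>).
  As the squares of the steps are summable, \<open>D\<close> converges along the iterates; a positive limit would
  make the steps themselves summable (\<open>quasi_descent_tendsto_zero\<close>).

  Bounding its right side from above by \<open>L * D u + \<rho> * D u powr (1 + \<nu>)\<close>: the values at the iterates
  converge to the minimum because \<open>D\<close> tends to zero along them.
\<close>

section \<open>Paraconvex functions\<close>

lemma paraconvex_on_ereal_iff:
  "paraconvex_on S \<nu> \<rho> (\<lambda>x. ereal (g x)) \<longleftrightarrow>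
     (\<forall>x\<in>S. \<forall>y\<in>S. \<forall>t\<in>{0..1}. g (t *\<^sub>R x + (1 - t) *\<^sub>R y)
        \<le> t * g x + (1 - t) * g y + \<rho> * min t (1 - t) * norm (x - y) powr (1 + \<nu>))"
  by (simp add: paraconvex_on_def)

lemma paraconvex_onD_real:
  assumes "paraconvex_on S \<nu> \<rho> (\<lambda>x. ereal (g x))" "x \<in> S" "y \<in> S" "0 \<le> t" "t \<le> 1"
  shows "g (t *\<^sub>R x + (1 - t) *\<^sub>R y)
    \<le> t * g x + (1 - t) * g y + \<rho> * min t (1 - t) * norm (x - y) powr (1 + \<nu>)"
  using assms unfolding paraconvex_on_ereal_iff by simp

lemma paraconvex_on_cong:
  assumes "convex S" "\<And>x. x \<in> S \<Longrightarrow> f x = h x" "paraconvex_on S \<nu> \<rho> f"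
  shows "paraconvex_on S \<nu> \<rho> h"
  unfolding paraconvex_on_def
proof (intro ballI)
  fix x y t assume *: "x \<in> S" "y \<in> S" "t \<in> {0..1::real}"
  then have "t *\<^sub>R x + (1 - t) *\<^sub>R y \<in> S"
    using assms(1) by (auto intro: convexD)
  then show "h (t *\<^sub>R x + (1 - t) *\<^sub>R y) \<le> ereal t * h x + ereal (1 - t) * h y
      + ereal (\<rho> * min t (1 - t) * norm (x - y) powr (1 + \<nu>))"
    using assms(2,3) * unfolding paraconvex_on_def by metis
qed

text \<open>
  Every point of the hull arises by joining vertices one at a time, and each of these finitely many
  steps has a paraconvexity defect of at most \<open>\<rho> * D powr (1 + \<nu>)\<close>, with \<open>D\<close> a bound on the length
  of the segments.
\<close>

lemma paraconvex_on_bdd_above_convex_hull: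
  fixes g :: "'a::real_normed_vector \<Rightarrow> real"
  assumes "finite V" "convex S" "V \<subseteq> S" "0 \<le> \<rho>" "0 \<le> \<nu>"
    and para: "paraconvex_on S \<nu> \<rho> (\<lambda>x. ereal (g x))"
  shows "\<exists>M. \<forall>z\<in>convex hull V. g z \<le> M"
  using assms(1,3)
proof (induction V rule: finite_induct)
  case empty
  then show ?case by simp
next
  case (insert a V)
  show ?case
  proof (cases "V = {}")
    case True
    then show ?thesis by auto
  next
    case False
    obtain M where M: "\<And>z. z \<in> convex hull V \<Longrightarrow> g z \<le> M"
      using insert by auto
    have "bounded (convex hull (insert a V))"
      using insert by (simp add: finite_imp_bounded bounded_convex_hull)
    then obtain D where D: "\<And>z. z \<in> convex hull (insert a V) \<Longrightarrow> dist a z \<le> D"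
      unfolding bounded_any_center[of _ a] by blast
    have "g z \<le> \<bar>g a\<bar> + \<bar>M\<bar> + \<rho> * D powr (1 + \<nu>)" if z: "z \<in> convex hull (insert a V)" for z
    proof -
      obtain u b where u: "0 \<le> u" "u \<le> 1" and b: "b \<in> convex hull V"
        and zeq: "z = u *\<^sub>R a + (1 - u) *\<^sub>R b"
      proof -
        obtain u w b where "0 \<le> u" "0 \<le> w" "u + w = 1" "b \<in> convex hull V" "z = u *\<^sub>R a + w *\<^sub>R b"
          using z unfolding convex_hull_insert[OF False] by auto
        moreover from this have "w = 1 - u" by linarith
        ultimately show ?thesis using that[of u b] by simp
      qed
      have bS: "b \<in> S"
        using b insert.prems assms(2) by (metis hull_minimal in_mono insert_subset)
      have aS: "a \<in> S" using insert by auto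
      have "norm (a - b) \<le> D"
        using D[of b] b by (metis dist_norm hull_mono in_mono subset_insertI)
      then have 1: "min u (1 - u) * norm (a - b) powr (1 + \<nu>) \<le> 1 * D powr (1 + \<nu>)"
        using u assms by (intro mult_mono powr_mono2) auto
      have 2: "u * g a \<le> \<bar>g a\<bar>"
        using u by (metis abs_ge_self abs_ge_zero abs_mult abs_of_nonneg mult_left_le_one_le order_trans)
      have 3: "(1 - u) * g b \<le> \<bar>M\<bar>"
      proof -
        have "(1 - u) * g b \<le> (1 - u) * \<bar>M\<bar>" using M[OF b] u by (intro mult_left_mono) auto
        also have "\<dots> \<le> \<bar>M\<bar>" using u by (simp add: mult_left_le_one_le)
        finally show ?thesis .
      qed
      have "\<rho> * min u (1 - u) * norm (a - b) powr (1 + \<nu>) \<le> \<rho> * D powr (1 + \<nu>)"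
        using mult_left_mono[OF 1, of \<rho>] assms by (simp add: mult.assoc)
      then show ?thesis
        using paraconvex_onD_real[OF para aS bS u] 2 3 unfolding zeq by linarith
    qed
    then show ?thesis by blast
  qed
qed

text \<open>
  As for convex functions, an upper bound on a ball suffices: the segment through \<open>x\<close> and \<open>y\<close> is
  extended to the boundary of the ball on both sides, and paraconvexity is applied once with \<open>y\<close> as
  the intermediate point and once with \<open>x\<close>.  The factor \<open>min t (1 - t)\<close> in the defect makes both
  errors linear in \<open>norm (y - x)\<close>.
\<close>

lemma paraconvex_on_locally_lipschitz_at:
  fixes g :: "'a::real_normed_vector \<Rightarrow> real"
  assumes para: "paraconvex_on S \<nu> \<rho> (\<lambda>x. ereal (g x))" and "0 \<le> \<rho>" "0 \<le> \<nu>" "0 < r"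
    and ball: "cball x r \<subseteq> S" and M: "\<And>z. z \<in> cball x r \<Longrightarrow> g z \<le> M"
    and y: "norm (y - x) \<le> r"
  shows "\<bar>g y - g x\<bar> \<le> (norm (y - x) / r) * (M - g x + \<rho> * (2 * r) powr (1 + \<nu>))"
proof (cases "y = x")
  case True
  then show ?thesis by simp
next
  case False
  define s where "s = norm (y - x) / r"
  define h where "h = (1 / s) *\<^sub>R (y - x)"
  define K where "K = \<rho> * (2 * r) powr (1 + \<nu>)"
  have s: "0 < s" "s \<le> 1" using False y \<open>0 < r\<close> by (auto simp: s_def)
  have h: "y - x = s *\<^sub>R h" "norm h = r"
    using s False \<open>0 < r\<close> by (auto simp: h_def s_def)
  have S: "x \<in> S" "y \<in> S" "x + h \<in> S" "x - h \<in> S"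
    using ball y h \<open>0 < r\<close> by (auto simp: subset_iff dist_norm norm_minus_commute)
  have MM: "g (x + h) \<le> M" "g (x - h) \<le> M"
    using M h by (auto simp: dist_norm)
  \<comment> \<open>Upper estimate: \<open>y\<close> lies between \<open>x\<close> and the boundary point \<open>x + h\<close>.\<close>
  have "g (s *\<^sub>R (x + h) + (1 - s) *\<^sub>R x)
      \<le> s * g (x + h) + (1 - s) * g x + \<rho> * min s (1 - s) * norm (x + h - x) powr (1 + \<nu>)"
    using s by (intro paraconvex_onD_real[OF para]) (use S in auto)
  moreover have "s *\<^sub>R (x + h) + (1 - s) *\<^sub>R x = y"
    using h(1) by (simp add: algebra_simps)
  moreover have "\<rho> * (min s (1 - s) * norm (x + h - x) powr (1 + \<nu>)) \<le> \<rho> * (s * (2 * r) powr (1 + \<nu>))"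
    using s h assms by (intro mult_left_mono mult_mono powr_mono2) auto
  moreover have "s * g (x + h) \<le> s * M" using MM s by simp
  ultimately have up: "g y - g x \<le> s * (M - g x + K)"
    by (simp add: K_def algebra_simps)
  \<comment> \<open>Lower estimate: \<open>x\<close> lies between \<open>y\<close> and the opposite boundary point \<open>x - h\<close>.\<close>
  define t where "t = s / (1 + s)"
  have t: "0 \<le> t" "t \<le> 1" "1 - t = 1 / (1 + s)" using s by (auto simp: t_def field_simps)
  have ts: "t = (1 - t) * s" using t by (simp add: t_def)
  have "norm (x - h - y) = norm ((- (1 + s)) *\<^sub>R h)"
    using h(1) by (intro arg_cong[where f = norm]) (simp add: algebra_simps)
  then have nrm: "norm (x - h - y) \<le> 2 * r" using h s \<open>0 < r\<close> by simp
  have "g (t *\<^sub>R (x - h) + (1 - t) *\<^sub>R y)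
      \<le> t * g (x - h) + (1 - t) * g y + \<rho> * min t (1 - t) * norm (x - h - y) powr (1 + \<nu>)"
    by (intro paraconvex_onD_real[OF para]) (use S t in auto)
  moreover have "t *\<^sub>R (x - h) + (1 - t) *\<^sub>R y = x"
  proof -
    have "t *\<^sub>R (x - h) + (1 - t) *\<^sub>R y = x + (1 - t) *\<^sub>R (y - x) - t *\<^sub>R h"
      by (simp add: algebra_simps)
    also have "\<dots> = x + ((1 - t) * s - t) *\<^sub>R h" unfolding h(1) by (simp add: algebra_simps)
    finally show ?thesis using ts by simp
  qed
  moreover have "\<rho> * (min t (1 - t) * norm (x - h - y) powr (1 + \<nu>)) \<le> \<rho> * (t * (2 * r) powr (1 + \<nu>))"
    using t nrm assms by (intro mult_left_mono mult_mono powr_mono2) auto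
  moreover have "t * g (x - h) \<le> t * M" using MM t by (simp add: mult_left_mono)
  ultimately have "g x \<le> t * M + (1 - t) * g y + t * K"
    by (simp add: K_def mult.assoc mult.left_commute)
  also have "\<dots> = (1 - t) * (s * M + g y + s * K)"
    by (subst (1 2) ts) (simp add: algebra_simps)
  finally have "g x * (1 + s) \<le> s * M + g y + s * K"
    using s unfolding t(3) by (simp add: field_simps)
  then have "g x - g y \<le> s * (M - g x + K)" by (simp add: algebra_simps)
  then show ?thesis using up unfolding s_def K_def by linarith
qed

text \<open>
  In finite dimension every point has a box around it inside the open set, and a box is the convex hull
  of finitely many points, so the function is locally bounded above.
\<close>

lemma paraconvex_on_imp_continuous_on:
  fixes g :: "'a::euclidean_space \<Rightarrow> real"
  assumes para: "paraconvex_on S \<nu> \<rho> (\<lambda>x. ereal (g x))" and "open S" "convex S" "0 \<le> \<rho>" "0 \<le> \<nu>"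
  shows "continuous_on S g"
  unfolding continuous_on_eq_continuous_at[OF \<open>open S\<close>]
proof
  fix x assume "x \<in> S"
  then obtain a b where ab: "cbox a b \<subseteq> S" "x \<in> box a b"
    using \<open>open S\<close> open_contains_cbox by metis
  obtain V where V: "finite V" "cbox a b = convex hull V"
    using polytope_interval[of a b] unfolding polytope_def by auto
  have "V \<subseteq> S" using V ab hull_subset by (metis order_trans)
  then obtain M where M: "\<And>z. z \<in> cbox a b \<Longrightarrow> g z \<le> M"
    using paraconvex_on_bdd_above_convex_hull[OF V(1) assms(3) _ assms(4,5) para] V(2) by auto
  obtain r where r: "r > 0" "cball x r \<subseteq> box a b"
    using ab(2) open_box open_contains_cball by metis
  then have r': "cball x r \<subseteq> cbox a b" using box_subset_cbox by blast
  define C where "C = M - g x + \<rho> * (2 * r) powr (1 + \<nu>)"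
  have "\<forall>\<^sub>F y in at x. norm (g y - g x) \<le> (norm (y - x) / r) * C"
    unfolding eventually_at
  proof (intro exI[of _ r] conjI ballI impI)
    fix y assume "y \<noteq> x \<and> dist y x < r"
    then show "norm (g y - g x) \<le> (norm (y - x) / r) * C"
      unfolding C_def real_norm_def
      by (intro paraconvex_on_locally_lipschitz_at[OF para])
         (use assms r r' ab M in \<open>auto simp: dist_norm\<close>)
  qed (use r in auto)
  moreover have "((\<lambda>y. (norm (y - x) / r) * C) \<longlongrightarrow> 0) (at x)"
  proof -
    have "((\<lambda>y. (norm (y - x) / r) * C) \<longlongrightarrow> (norm (x - x) / r) * C) (at x)"
      using r by (intro tendsto_intros) auto
    then show ?thesis by simp
  qed
  ultimately have "((\<lambda>y. g y - g x) \<longlongrightarrow> 0) (at x)"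
    by (rule Lim_null_comparison)
  then show "isCont g x" using LIM_zero_cancel isCont_def by blast
qed

text \<open>
  With \<open>v = y - x\<close>, the point \<open>w + t *\<^sub>R v\<close> lies on the segment from \<open>w\<close> to \<open>w + v\<close>, so paraconvexity
  bounds the difference quotient at \<open>w\<close> by \<open>g (w + v) - g w + \<rho> * norm v powr (1 + \<nu>)\<close>, uniformly
  in \<open>t\<close>.  By continuity of \<open>g\<close> at \<open>x\<close> and \<open>y\<close> this bound passes to the upper limit that defines
  the Clarke derivative.
\<close>

lemma clarke_subgradient_inequality:
  fixes f :: "'a::euclidean_space \<Rightarrow> ereal"
  assumes "open S" "convex S" and fin: "\<And>x. x \<in> S \<Longrightarrow> f x = ereal (g x)"
    and para: "paraconvex_on S \<nu> \<rho> (\<lambda>x. ereal (g x))" and "0 \<le> \<rho>" "0 \<le> \<nu>"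
    and x: "x \<in> S" and y: "y \<in> S" and z: "z \<in> clarke_subdiff f x"
  shows "g x + z \<bullet> (y - x) - \<rho> * norm (y - x) powr (1 + \<nu>) \<le> g y"
proof -
  define v where "v = y - x"
  define F where "F = nhds x \<times>\<^sub>F at_right (0::real)"
  define B where "B = (\<lambda>w. g (w + v) - g w + \<rho> * norm v powr (1 + \<nu>))"
  have cont: "isCont g x" "isCont g y"
    using paraconvex_on_imp_continuous_on[OF para] assms continuous_on_eq_continuous_at by blast+
  have "\<forall>\<^sub>F w in nhds x. w \<in> S \<and> w + v \<in> S"
  proof (intro eventually_conj)
    show "\<forall>\<^sub>F w in nhds x. w \<in> S" using assms eventually_nhds_in_open by blast
    have "((\<lambda>w. w + v) \<longlongrightarrow> x + v) (nhds x)"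
      by (intro tendsto_add tendsto_const) (simp add: filterlim_def)
    then show "\<forall>\<^sub>F w in nhds x. w + v \<in> S"
      using topological_tendstoD[OF _ \<open>open S\<close>] y unfolding v_def by fastforce
  qed
  moreover have "\<forall>\<^sub>F t in at_right 0. 0 < t \<and> t < (1::real)"
    by (auto simp: eventually_at_right_field intro: exI[of _ 1])
  ultimately have "\<forall>\<^sub>F p in F. (fst p \<in> S \<and> fst p + v \<in> S) \<and> 0 < snd p \<and> snd p < 1"
    unfolding F_def eventually_prod_filter by fastforce
  then have quot: "\<forall>\<^sub>F p in F. (case p of (w, t) \<Rightarrow> (f (w + t *\<^sub>R v) - f w) / ereal t) \<le> ereal (B (fst p))"
  proof (rule eventually_mono)
    fix p :: "'a \<times> real" assume p: "(fst p \<in> S \<and> fst p + v \<in> S) \<and> 0 < snd p \<and> snd p < 1"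
    obtain w :: 'a and t :: real where [simp]: "p = (w, t)" by force
    have eq: "t *\<^sub>R (w + v) + (1 - t) *\<^sub>R w = w + t *\<^sub>R v" by (simp add: algebra_simps)
    have "w + t *\<^sub>R v \<in> S"
      using convexD[OF \<open>convex S\<close>, of "w + v" w t "1 - t"] p eq by auto
    moreover have "(g (w + t *\<^sub>R v) - g w) / t \<le> B w"
    proof -
      have "g (w + t *\<^sub>R v) \<le> t * g (w + v) + (1 - t) * g w
          + \<rho> * min t (1 - t) * norm (w + v - w) powr (1 + \<nu>)"
        unfolding eq[symmetric] using p by (intro paraconvex_onD_real[OF para]) auto
      moreover have "\<rho> * (min t (1 - t) * norm v powr (1 + \<nu>)) \<le> \<rho> * (t * norm v powr (1 + \<nu>))"
        using assms by (intro mult_left_mono mult_right_mono) auto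
      ultimately show ?thesis using p by (simp add: B_def field_simps)
    qed
    ultimately show "(case p of (w, t) \<Rightarrow> (f (w + t *\<^sub>R v) - f w) / ereal t) \<le> ereal (B (fst p))"
      using p fin by simp
  qed
  have "ereal (z \<bullet> v) \<le> clarke_deriv f x v" using z unfolding clarke_subdiff_def by blast
  also have "\<dots> \<le> Limsup F (\<lambda>p. ereal (B (fst p)))"
    unfolding clarke_deriv_def F_def[symmetric] by (rule Limsup_mono[OF quot])
  also have "\<dots> = ereal (B x)"
  proof (rule lim_imp_Limsup)
    show "F \<noteq> bot" unfolding F_def by (simp add: prod_filter_eq_bot)
    have fst: "filterlim fst (nhds x) F" unfolding F_def by (rule filterlim_fst)
    have "((\<lambda>p. g (fst p)) \<longlongrightarrow> g x) F"
      by (rule isCont_tendsto_compose[OF cont(1) fst])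
    moreover have "((\<lambda>p. g (fst p + v)) \<longlongrightarrow> g y) F"
      by (rule isCont_tendsto_compose[OF cont(2)])
         (use tendsto_add[OF fst tendsto_const[of v]] in \<open>simp add: v_def\<close>)
    ultimately show "((\<lambda>p. ereal (B (fst p))) \<longlongrightarrow> ereal (B x)) F"
      unfolding B_def by (intro tendsto_intros) (simp_all add: v_def)
  qed
  finally show ?thesis by (simp add: B_def v_def)
qed

section \<open>One step of the projected subgradient method\<close>

text \<open>
  Expanding the square of the unprojected step gives the estimate, and since \<open>p\<close> lies in \<open>X\<close> the
  projection does not increase the distance to \<open>p\<close>.
\<close>

lemma normalized_projected_step_dist:
  fixes X :: "'a::euclidean_space set"
  assumes "closed X" "convex X" "p \<in> X" "z \<noteq> 0" "norm z \<le> L" "0 \<le> a" "0 \<le> s" "s \<le> z \<bullet> (u - p)"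
  shows "(norm (closest_point X (u - (a / norm z) *\<^sub>R z) - p))\<^sup>2 \<le> (norm (u - p))\<^sup>2 - 2 * a * (s / L) + a\<^sup>2"
proof -
  define w where "w = u - (a / norm z) *\<^sub>R z"
  have "dist (closest_point X w) (closest_point X p) \<le> dist w p"
    using assms by (intro closest_point_lipschitz) auto
  then have "(norm (closest_point X w - p))\<^sup>2 \<le> (norm (w - p))\<^sup>2"
    using assms by (simp add: closest_point_self dist_norm)
  also have "\<dots> = (norm ((u - p) - (a / norm z) *\<^sub>R z))\<^sup>2"
    by (simp add: w_def algebra_simps)
  also have "\<dots> = (norm (u - p))\<^sup>2 - 2 * ((a / norm z) * (z \<bullet> (u - p))) + (norm ((a / norm z) *\<^sub>R z))\<^sup>2"
    using dot_norm_neg[of "u - p" "(a / norm z) *\<^sub>R z"] inner_commute[of "u - p" z] by simp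
  also have "norm ((a / norm z) *\<^sub>R z) = a" using assms(4,6) by simp
  also have "(norm (u - p))\<^sup>2 - 2 * ((a / norm z) * (z \<bullet> (u - p))) + a\<^sup>2
      \<le> (norm (u - p))\<^sup>2 - 2 * a * (s / L) + a\<^sup>2"
  proof -
    have "s / L \<le> (z \<bullet> (u - p)) / norm z"
      using assms by (intro frac_le) auto
    then have "a * (s / L) \<le> a * ((z \<bullet> (u - p)) / norm z)" using assms by (intro mult_left_mono) auto
    then show ?thesis by simp
  qed
  finally show ?thesis by (simp add: w_def)
qed

text \<open>
  The radius solves \<open>\<rho> * R powr (1 + \<nu>) = \<gamma> * \<mu> * R powr (1 / \<delta>)\<close>; the left side has the larger
  exponent and is therefore the smaller one below \<open>R\<close>.
\<close>

lemma tube_radius_bound: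
  fixes \<delta> \<nu> \<mu> \<rho> \<gamma> d :: real
  assumes "0 < \<rho>" "0 < \<mu>" "0 < \<gamma>" "0 < \<delta>" "1 < \<delta> * (1 + \<nu>)"
    and "0 \<le> d" "d < (\<gamma> * \<mu> / \<rho>) powr (\<delta> / (\<delta> * (1 + \<nu>) - 1))"
  shows "\<rho> * d powr (1 + \<nu>) \<le> \<gamma> * \<mu> * d powr (1 / \<delta>)"
proof (cases "d = 0")
  case False
  define \<tau> where "\<tau> = 1 + \<nu> - 1 / \<delta>"
  have \<tau>: "0 < \<tau>" "\<delta> / (\<delta> * (1 + \<nu>) - 1) * \<tau> = 1"
  proof -
    have "\<tau> = (\<delta> * (1 + \<nu>) - 1) / \<delta>" using assms by (simp add: \<tau>_def field_simps)
    then show "0 < \<tau>" "\<delta> / (\<delta> * (1 + \<nu>) - 1) * \<tau> = 1" using assms by auto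
  qed
  have "d powr \<tau> \<le> ((\<gamma> * \<mu> / \<rho>) powr (\<delta> / (\<delta> * (1 + \<nu>) - 1))) powr \<tau>"
    using assms \<tau> by (intro powr_mono2) auto
  also have "\<dots> = \<gamma> * \<mu> / \<rho>"
    unfolding powr_powr \<tau>(2) using assms by simp
  finally have "\<rho> * d powr \<tau> \<le> \<gamma> * \<mu>" using assms by (simp add: field_simps)
  then have "\<rho> * d powr \<tau> * d powr (1 / \<delta>) \<le> \<gamma> * \<mu> * d powr (1 / \<delta>)"
    by (intro mult_right_mono) auto
  moreover have "d powr (1 + \<nu>) = d powr \<tau> * d powr (1 / \<delta>)"
    by (simp add: \<tau>_def powr_add[symmetric])
  ultimately show ?thesis by (simp add: mult.assoc)
qed (use assms in auto)

text \<open>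
  As a function of \<open>s = d powr q\<close> the right-hand side \<open>s powr (2 / q) - c * a * s + a\<^sup>2\<close> is convex for \<open>q \<le> 2\<close>, so on
  \<open>0 \<le> d \<le> R\<close> it is largest at an end point.  At \<open>d = R\<close> it is below \<open>R\<^sup>2\<close> because
  \<open>a < c * R powr q\<close>; at \<open>d = 0\<close> it is \<open>a\<^sup>2\<close>, and \<open>a < R\<close> follows from \<open>a < 1\<close> if \<open>R \<ge> 1\<close> and
  from \<open>a < R powr q \<le> R\<close> if \<open>R < 1\<close>.
\<close>

lemma radius_preserved:
  fixes a c d q R e :: real
  assumes "0 \<le> d" "d < R" "1 \<le> q" "q \<le> 2" "0 < a" "a < 1" "a < R powr q" "a < c * R powr q"
    and e: "0 \<le> e" "e\<^sup>2 \<le> d\<^sup>2 - c * a * d powr q + a\<^sup>2"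
  shows "e < R"
proof -
  have R: "0 < R" using assms by linarith
  \<comment> \<open>\<open>\<theta>\<close> is the position of \<open>d powr q\<close> between the end points \<open>0\<close> and \<open>R powr q\<close>.\<close>
  define \<theta> where "\<theta> = (d / R) powr q"
  have dR: "0 \<le> d / R" "d / R \<le> 1" using assms R by auto
  have \<theta>: "0 \<le> \<theta>" "\<theta> \<le> 1" using dR assms unfolding \<theta>_def by (auto intro: powr_le1)
  have dq: "d powr q = \<theta> * R powr q"
    using R assms by (simp add: \<theta>_def powr_divide)
  have "(d / R)\<^sup>2 \<le> \<theta>"
  proof (cases "d = 0")
    case False
    then have "(d / R)\<^sup>2 = (d / R) powr 2" using dR by simp
    also have "\<dots> \<le> \<theta>" unfolding \<theta>_def using dR assms(4) by (intro powr_mono') auto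
    finally show ?thesis .
  qed (simp add: \<theta>_def)
  then have d2: "d\<^sup>2 \<le> \<theta> * R\<^sup>2" using R by (simp add: field_simps)
  have aR: "a < R"
  proof (cases "R < 1")
    case True
    then have "R powr q \<le> R powr 1" using R assms by (intro powr_mono') auto
    then show ?thesis using assms R by simp
  qed (use assms in linarith)
  have a2: "a\<^sup>2 < R\<^sup>2" using aR assms by (intro power_strict_mono) auto
  have "a * a < a * (c * R powr q)" using assms by (intro mult_strict_left_mono) auto
  then have end_R: "R\<^sup>2 - c * a * R powr q + a\<^sup>2 < R\<^sup>2" by (simp add: power2_eq_square algebra_simps)
  have "e\<^sup>2 \<le> \<theta> * (R\<^sup>2 - c * a * R powr q + a\<^sup>2) + (1 - \<theta>) * a\<^sup>2"
    using e(2) d2 dq by (simp add: algebra_simps)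
  also have "\<dots> < R\<^sup>2"
    using convex_bound_lt[OF end_R a2, of \<theta> "1 - \<theta>"] \<theta> by simp
  finally show ?thesis using R by (simp add: power_less_imp_less_base)
qed

section \<open>Sequences that decrease up to a summable perturbation\<close>

text \<open>
  Adding the accumulated decrements and subtracting the accumulated perturbations turns \<open>v\<close> into a
  decreasing sequence bounded below by minus the total perturbation.
\<close>

lemma quasi_descent_convergent:
  fixes v b w :: "nat \<Rightarrow> real"
  assumes "\<And>k. 0 \<le> v k" "\<And>k. 0 \<le> b k" "\<And>k. 0 \<le> w k" "summable b"
    and step: "\<And>k. v (Suc k) \<le> v k - w k + b k"
  shows "convergent v" "summable w"
proof -
  define u where "u n = v n + (\<Sum>k<n. w k) - (\<Sum>k<n. b k)" for n
  have "u (Suc n) \<le> u n" for n using step[of n] by (simp add: u_def)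
  then have "decseq u" by (rule decseq_SucI)
  have bB: "(\<Sum>k<n. b k) \<le> suminf b" for n using assms by (intro sum_le_suminf) auto
  have "(\<Sum>k<n. w k) \<le> u 0 + suminf b" for n
    using decseqD[OF \<open>decseq u\<close>, of 0 n] assms(1)[of n] bB[of n] by (simp add: u_def)
  then show w: "summable w" using assms by (intro summableI_nonneg_bounded) auto
  have "- suminf b \<le> u n" for n
    using assms(1)[of n] bB[of n] sum_nonneg[of "{..<n}" w] assms(3) by (simp add: u_def)
  then have "convergent u" using decseq_convergent[OF \<open>decseq u\<close>] by (metis convergentI)
  moreover have "convergent (\<lambda>n. \<Sum>k<n. w k)" "convergent (\<lambda>n. \<Sum>k<n. b k)"
    using w assms(4) summable_iff_convergent by auto
  ultimately have "convergent (\<lambda>n. u n - (\<Sum>k<n. w k) + (\<Sum>k<n. b k))"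
    by (intro convergent_add convergent_diff)
  then show "convergent v" by (simp add: u_def)
qed

text \<open>
  If the limit of \<open>d\<close> were positive, the decrements \<open>c * a k * d k powr q\<close> would eventually dominate a
  fixed positive multiple of \<open>a k\<close>; but they are summable.
\<close>

lemma quasi_descent_tendsto_zero:
  fixes a d :: "nat \<Rightarrow> real"
  assumes "\<And>k. 0 \<le> d k" "\<And>k. 0 \<le> a k" "0 < c" "0 \<le> q"
    and "summable (\<lambda>k. (a k)\<^sup>2)" "\<not> summable a"
    and step: "\<And>k. (d (Suc k))\<^sup>2 \<le> (d k)\<^sup>2 - c * a k * d k powr q + (a k)\<^sup>2"
  shows "d \<longlonglongrightarrow> 0"
proof -
  have *: "convergent (\<lambda>k. (d k)\<^sup>2)" "summable (\<lambda>k. c * a k * d k powr q)"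
    by (rule quasi_descent_convergent[where v = "\<lambda>k. (d k)\<^sup>2" and b = "\<lambda>k. (a k)\<^sup>2"
            and w = "\<lambda>k. c * a k * d k powr q"]; use assms in simp)+
  obtain l where l: "(\<lambda>k. (d k)\<^sup>2) \<longlonglongrightarrow> l" using * convergent_def by blast
  have "(\<lambda>k. sqrt ((d k)\<^sup>2)) \<longlonglongrightarrow> sqrt l" using l by (rule tendsto_real_sqrt)
  then have m: "d \<longlonglongrightarrow> sqrt l" using assms(1) by simp
  have "0 \<le> sqrt l" using m assms(1) LIMSEQ_le_const by blast
  moreover have "\<not> 0 < sqrt l"
  proof
    assume pos: "0 < sqrt l"
    define e where "e = c * (sqrt l / 2) powr q"
    have e: "0 < e" using pos assms by (simp add: e_def)
    have "\<forall>\<^sub>F k in sequentially. sqrt l / 2 < d k"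
      using order_tendstoD(1)[OF m, of "sqrt l / 2"] pos by simp
    then have "\<forall>\<^sub>F k in sequentially. norm (e * a k) \<le> c * a k * d k powr q"
    proof (rule eventually_mono)
      fix k assume "sqrt l / 2 < d k"
      then have "(sqrt l / 2) powr q \<le> d k powr q" using pos assms by (intro powr_mono2) auto
      then have "(c * a k) * (sqrt l / 2) powr q \<le> (c * a k) * d k powr q"
        using assms by (intro mult_left_mono) auto
      then show "norm (e * a k) \<le> c * a k * d k powr q"
        using e assms(2)[of k] assms(3) by (simp add: e_def abs_mult mult.assoc mult.left_commute mult.commute)
    qed
    then have "summable (\<lambda>k. e * a k)" using *(2) by (rule summable_comparison_test_ev)
    then show False using e assms(6) by simp
  qed
  ultimately show ?thesis using m by simp
qed

section \<open>Convergence of the method\<close>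

theorem theorem4p7:
  fixes f :: "real ^ 'n \<Rightarrow> ereal"
    and X X' :: "(real ^ 'n) set"
    and \<nu> \<rho> \<delta> \<mu> L :: real
    and \<alpha> :: "nat \<Rightarrow> real"
    and \<zeta> x :: "nat \<Rightarrow> real ^ 'n"
  assumes "proper_fun f"
    and "X \<noteq> {}" and "closed X" and "convex X" and "X \<subseteq> effective_domain f"
    and "argmin_set f X \<noteq> {}"
    and "0 < \<rho>" and "0 < \<nu>" and "\<nu> \<le> 1" and "1 / (1 + \<nu>) < \<delta>" and "\<delta> \<le> 1" and "0 < \<mu>"
    and "open X'" and "convex X'" and "X \<subseteq> X'" and "X' \<subseteq> effective_domain f"
    and "paraconvex_on X' \<nu> \<rho> f"
    and "holder_error_bound f X \<mu> \<delta>"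
    and "ereal L = Sup {ereal (norm z) | z y. y \<in> tube f X \<nu> \<rho> \<delta> \<mu> 1 \<and> z \<in> clarke_subdiff f y}"
    and "0 < L"
    and "projected_subgradient f X \<alpha> \<zeta> x"
    and "x 1 \<in> tube f X \<nu> \<rho> \<delta> \<mu> (1 / 2)"
    and "\<not> summable (\<lambda>k. \<alpha> (Suc k))"
    and "summable (\<lambda>k. (\<alpha> (Suc k))\<^sup>2)"
    and "\<forall>k\<ge>1. 0 \<le> \<alpha> k \<and>
           \<alpha> k < min 1 (min 1 (\<mu> / L) * (\<mu> / (2 * \<rho>)) powr (1 / (\<delta> * (1 + \<nu>) - 1)))"
  shows "((\<lambda>k. f (x k)) \<longlonglongrightarrow> min_value f X) \<and>
         ((\<lambda>k. Min ((\<lambda>i. f (x i)) ` {1..k})) \<longlonglongrightarrow> min_value f X) \<and>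
         ((\<lambda>k. infdist (x k) (argmin_set f X)) \<longlonglongrightarrow> 0)"
proof -
  define A where "A = argmin_set f X"
  define g where "g = (\<lambda>u. real_of_ereal (f u))"
  define D where "D = (\<lambda>u. infdist u A)"
  define q where "q = 1 / \<delta>"
  define R where "R = (1 / 2 * \<mu> / \<rho>) powr (\<delta> / (\<delta> * (1 + \<nu>) - 1))"
  define c where "c = \<mu> / L"
  have \<delta>: "0 < \<delta>" "1 < \<delta> * (1 + \<nu>)"
  proof -
    show "0 < \<delta>" using assms(8,10) by (meson add_pos_pos less_trans zero_less_divide_1_iff zero_less_one)
    show "1 < \<delta> * (1 + \<nu>)" using assms(8,10) by (simp add: field_simps)
  qed
  have q: "1 \<le> q" "q \<le> 2"
  proof -
    show "1 \<le> q" using \<delta> assms(11) by (simp add: q_def)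
    have "\<delta> * (1 + \<nu>) \<le> \<delta> * 2" using \<delta> assms(9) by (intro mult_left_mono) auto
    then have "1 \<le> 2 * \<delta>" using \<delta>(2) by linarith
    then show "q \<le> 2" using \<delta>(1) by (simp add: q_def field_simps)
  qed
  have c: "0 < c" using assms(12,20) by (simp add: c_def)

  have fin: "f u = ereal (g u)" if "u \<in> X'" for u
  proof -
    have "f u \<noteq> \<infinity>" using that assms(16) by (auto simp: effective_domain_def)
    moreover have "f u \<noteq> -\<infinity>" using assms(1) by (simp add: proper_fun_def)
    ultimately show ?thesis unfolding g_def by (cases "f u") auto
  qed
  then have finX: "f u = ereal (g u)" if "u \<in> X" for u using that assms(15) by blast
  have para: "paraconvex_on X' \<nu> \<rho> (\<lambda>u. ereal (g u))"
    using paraconvex_on_cong[OF assms(14) fin assms(17)] by blast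
  have \<rho>\<nu>: "0 \<le> \<rho>" "0 \<le> \<nu>" using assms(7,8) by auto
  have cont: "continuous_on X g"
    using paraconvex_on_imp_continuous_on[OF para assms(13,14) \<rho>\<nu>] assms(15) continuous_on_subset by blast

  obtain m where m: "m \<in> A" using assms(6) A_def by blast
  then have mX: "m \<in> X" and m_min: "\<And>u. u \<in> X \<Longrightarrow> g m \<le> g u"
    unfolding A_def argmin_set_def is_arg_min_def using finX by (auto simp: not_less)
  have fstar: "min_value f X = ereal (g m)"
    unfolding min_value_def
    by (rule antisym) (use mX m_min finX in \<open>auto intro!: INF_lower2[OF mX] INF_greatest\<close>)
  have A_eq: "A = {u \<in> X. g u \<le> g m}"
    unfolding A_def argmin_set_def is_arg_min_def
    using finX mX m_min by (fastforce simp: not_less intro: order_trans)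
  have "closed A"
  proof -
    have "A = X \<inter> g -` {..g m}" using A_eq by auto
    then show ?thesis using continuous_closed_preimage[OF cont assms(3) closed_atMost] by simp
  qed
  have eb: "\<mu> * D u powr q \<le> g u - g m" if "u \<in> X" for u
    using assms(18) that finX[OF that] fstar
    unfolding holder_error_bound_def A_def[symmetric] D_def q_def by fastforce
  have D0: "0 \<le> D u" for u by (simp add: D_def infdist_nonneg)
  \<comment> \<open>Any choice of nearest minimizers will do; they need not be unique, since \<open>A\<close> may fail to be
    convex.\<close>
  obtain P where P: "\<And>u. P u \<in> A" "\<And>u. norm (u - P u) = D u"
  proof -
    have "\<forall>u. \<exists>p. p \<in> A \<and> norm (u - p) = D u"
      using infdist_attains_inf[OF \<open>closed A\<close>] m unfolding D_def dist_norm by (metis empty_iff)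
    then show ?thesis using that by metis
  qed
  have PX: "P u \<in> X" "g (P u) = g m" for u
    using P(1)[of u] m_min[of "P u"] unfolding A_eq by auto

  have sub: "g u - g m \<le> z \<bullet> (u - P u) + \<rho> * D u powr (1 + \<nu>)"
    if "u \<in> X" "z \<in> clarke_subdiff f u" for u z
  proof -
    have "g u + z \<bullet> (P u - u) - \<rho> * norm (P u - u) powr (1 + \<nu>) \<le> g (P u)"
      by (rule clarke_subgradient_inequality[OF assms(13,14) fin para \<rho>\<nu>])
        (use that PX assms(15) in auto)
    then show ?thesis
      using P(2)[of u] PX(2)[of u] by (simp add: norm_minus_commute inner_diff_right)
  qed
  \<comment> \<open>In the tube the paraconvexity defect is at most half of the error bound, which leaves
    half of it as a lower bound for \<open>z \<bullet> (u - P u)\<close>.\<close>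
  have half: "\<rho> * D u powr (1 + \<nu>) \<le> \<mu> / 2 * D u powr q" if "D u < R" for u
    using tube_radius_bound[OF assms(7,12) _ \<delta> D0[of u], where \<gamma> = "1 / 2"] that
    by (simp add: R_def q_def)
  have sharp: "\<mu> / 2 * D u powr q \<le> z \<bullet> (u - P u)"
    if "u \<in> X" "D u < R" "z \<in> clarke_subdiff f u" for u z
    using sub[OF that(1,3)] eb[OF that(1)] half[OF that(2)] by linarith

  have bound: "norm z \<le> L" if "u \<in> X" "D u < R" "z \<in> clarke_subdiff f u" for u z
  proof -
    have "R \<le> (1 * \<mu> / \<rho>) powr (\<delta> / (\<delta> * (1 + \<nu>) - 1))"
      unfolding R_def using assms(7,12) \<delta> by (intro powr_mono2) (auto simp: field_simps)
    then have "u \<in> tube f X \<nu> \<rho> \<delta> \<mu> 1"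
      using that unfolding tube_def D_def A_def by auto
    then have "ereal (norm z) \<le> ereal L"
      unfolding assms(19) using that by (intro Sup_upper) blast
    then show ?thesis by simp
  qed

  have \<zeta>: "\<zeta> k \<in> clarke_subdiff f (x k)" and
    next_x: "x (Suc k) = (if \<zeta> k = 0 then x k
      else closest_point X (x k - (\<alpha> k / norm (\<zeta> k)) *\<^sub>R \<zeta> k))" if "1 \<le> k" for k
    using assms(21) that unfolding projected_subgradient_def by auto
  have Rq: "R powr q = (\<mu> / (2 * \<rho>)) powr (1 / (\<delta> * (1 + \<nu>) - 1))"
    using \<delta> by (simp add: R_def q_def powr_powr)
  have \<alpha>: "0 \<le> \<alpha> k" "\<alpha> k < 1" "\<alpha> k < R powr q" "\<alpha> k < c * R powr q" if "1 \<le> k" for k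
  proof -
    have *: "0 \<le> \<alpha> k" "\<alpha> k < 1" "\<alpha> k < min 1 c * R powr q"
      using assms(25) that unfolding Rq c_def by auto
    then show "0 \<le> \<alpha> k" "\<alpha> k < 1" by auto
    have "min 1 c * R powr q \<le> 1 * R powr q" "min 1 c * R powr q \<le> c * R powr q"
      by (intro mult_right_mono; simp)+
    then show "\<alpha> k < R powr q" "\<alpha> k < c * R powr q" using * by linarith+
  qed

  have step: "(D (x (Suc k)))\<^sup>2 \<le> (D (x k))\<^sup>2 - c * \<alpha> k * D (x k) powr q + (\<alpha> k)\<^sup>2"
    if k: "1 \<le> k" and xk: "x k \<in> X" "D (x k) < R" for k
  proof (cases "\<zeta> k = 0")
    \<comment> \<open>A stationary point of the tube is a minimizer, because \<open>sharp\<close> forces \<open>D (x k) = 0\<close>.\<close>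
    case True
    then have "\<mu> / 2 * D (x k) powr q \<le> 0" using sharp[OF xk \<zeta>[OF k]] by simp
    then have "D (x k) powr q = 0" using assms(12) powr_ge_zero[of "D (x k)" q]
      by (simp add: mult_le_0_iff)
    then show ?thesis using next_x[OF k] True by simp
  next
    case False
    define p where "p = P (x k)"
    have "D (x (Suc k)) \<le> norm (x (Suc k) - p)"
      using infdist_le[OF P(1), of "x (Suc k)" "x k"] by (simp add: D_def p_def dist_norm)
    then have "(D (x (Suc k)))\<^sup>2 \<le> (norm (x (Suc k) - p))\<^sup>2" using D0 by (simp add: power_mono)
    also have "\<dots> \<le> (norm (x k - p))\<^sup>2 - 2 * \<alpha> k * (\<mu> / 2 * D (x k) powr q / L) + (\<alpha> k)\<^sup>2"
      unfolding next_x[OF k] if_not_P[OF False]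
      by (rule normalized_projected_step_dist)
        (use assms(3,4,12) PX False bound[OF xk \<zeta>[OF k]] \<alpha>[OF k] sharp[OF xk \<zeta>[OF k]] in \<open>auto simp: p_def\<close>)
    finally show ?thesis by (simp add: p_def P c_def mult_ac)
  qed
  have inv: "x (Suc k) \<in> X \<and> D (x (Suc k)) < R" for k
  proof (induction k)
    case 0
    then show ?case using assms(22) by (simp add: tube_def D_def A_def R_def)
  next
    case (Suc k)
    let ?k = "Suc k"
    have k: "1 \<le> ?k" by simp
    have "x (Suc ?k) \<in> X"
      using next_x[OF k] Suc closest_point_in_set[OF assms(3,2)] by simp
    moreover have "D (x (Suc ?k)) < R"
    proof (cases "\<alpha> ?k = 0")
      case True
      then have "(D (x (Suc ?k)))\<^sup>2 \<le> (D (x ?k))\<^sup>2" using step[OF k] Suc by simp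
      then have "D (x (Suc ?k)) \<le> D (x ?k)" using D0 by (rule power2_le_imp_le)
      then show ?thesis using Suc by simp
    next
      case False
      then have "0 < \<alpha> ?k" using \<alpha>(1)[OF k] by simp
      then show ?thesis
        using radius_preserved[OF D0 _ q _ \<alpha>(2-4)[OF k] D0 step[OF k]] Suc by blast
    qed
    ultimately show ?case by simp
  qed

  have "(\<lambda>k. D (x (Suc k))) \<longlonglongrightarrow> 0"
    by (rule quasi_descent_tendsto_zero[where a = "\<lambda>k. \<alpha> (Suc k)" and c = c and q = q])
      (use D0 \<alpha>(1) c q assms(23,24) step inv in simp_all)
  then have dist_lim: "(\<lambda>k. D (x k)) \<longlonglongrightarrow> 0" by (rule LIMSEQ_imp_Suc)

  have inv1: "x k \<in> X" "D (x k) < R" if "1 \<le> k" for k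
    using inv[of "k - 1"] that by auto
  have upper: "g (x k) - g m \<le> L * D (x k) + \<rho> * D (x k) powr (1 + \<nu>)" if k: "1 \<le> k" for k
  proof -
    have "\<zeta> k \<bullet> (x k - P (x k)) \<le> norm (\<zeta> k) * D (x k)"
      using norm_cauchy_schwarz[of "\<zeta> k" "x k - P (x k)"] P(2) by simp
    also have "\<dots> \<le> L * D (x k)"
      using bound[OF inv1[OF k] \<zeta>[OF k]] D0 by (intro mult_right_mono) auto
    finally show ?thesis using sub[OF inv1(1)[OF k] \<zeta>[OF k]] by linarith
  qed
  \<comment> \<open>The subgradients \<open>\<zeta> k\<close> chosen by the method have norm at most \<open>L\<close>, so they turn the distance to
    the nearest minimizer into a bound on the value at the iterate itself.\<close>
  have "(\<lambda>k. L * D (x k) + \<rho> * D (x k) powr (1 + \<nu>)) \<longlonglongrightarrow> L * 0 + \<rho> * 0"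
    by (intro tendsto_intros dist_lim tendsto_zero_powrI[OF dist_lim tendsto_const])
      (use \<rho>\<nu> D0 in auto)
  then have "(\<lambda>k. L * D (x k) + \<rho> * D (x k) powr (1 + \<nu>)) \<longlonglongrightarrow> 0" by simp
  then have "(\<lambda>k. g (x k) - g m) \<longlonglongrightarrow> 0"
    by (rule real_tendsto_sandwich[OF _ _ tendsto_const, rotated 2])
      (use upper inv1 m_min in \<open>auto simp: eventually_sequentially intro!: exI[of _ 1]\<close>)
  then have "(\<lambda>k. ereal (g (x k))) \<longlonglongrightarrow> ereal (g m)"
    by (intro tendsto_ereal) (rule LIM_zero_cancel)
  moreover have "\<forall>\<^sub>F k in sequentially. ereal (g (x k)) = f (x k)"
    unfolding eventually_sequentially using inv1 finX by (intro exI[of _ 1]) auto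
  ultimately have f_lim: "(\<lambda>k. f (x k)) \<longlonglongrightarrow> min_value f X"
    unfolding fstar by (rule Lim_transform_eventually)
  have "(\<lambda>k. Min ((\<lambda>i. f (x i)) ` {1..k})) \<longlonglongrightarrow> min_value f X"
  proof (rule tendsto_sandwich[OF _ _ tendsto_const f_lim])
    show "\<forall>\<^sub>F k in sequentially. min_value f X \<le> Min ((\<lambda>i. f (x i)) ` {1..k})"
      unfolding eventually_sequentially fstar
      using inv1 finX m_min by (intro exI[of _ 1]) auto
    show "\<forall>\<^sub>F k in sequentially. Min ((\<lambda>i. f (x i)) ` {1..k}) \<le> f (x k)"
      unfolding eventually_sequentially by (intro exI[of _ 1]) auto
  qed
  then show ?thesis using f_lim dist_lim unfolding D_def A_def by blast
qed

end
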